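(* Let $a_1, b \in \mathbb{N}$ and let $$n = \frac{2^{a_1+6b+2(-1)^{a_1 \bmod 2}}}{3^2}-\frac{2^{a_1}}{3^2}-\frac{2^0}{3^1}.$$ Then $n$ is a positive odd integer and $C^2(n) = 1$.
   Context: $\mathbb{N}$ denotes the positive integers and $\mathbb{O}_+$ the set of positive odd integers. The reduced Collatz function $C : \mathbb{O}_+ \to \mathbb{O}_+$ is $C(n) = \frac{3n+1}{2^a}$, where $a \in \mathbb{N}$ is the largest exponent such that $2^a \mid 3n+1$. $C^i$ denotes the $i$-th iterate of $C$. Here $a_1 \bmod 2 \in \{0,1\}$ is the remainder of $a_1$ modulo $2$. *)

theory Defs
  imports Complex_Main "HOL-Computational_Algebra.Primes"
begin

definition pos_odds :: "nat set" where
  "pos_odds = {n. 0 < n \<and> odd n}"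

text \<open>
  The reduced Collatz function is meant on \<^const>\<open>pos_odds\<close> only, although it is total on
  \<^typ>\<open>nat\<close>. The lemmas show that the division is exact, that the exponent is the largest one
  and is positive on \<^const>\<open>pos_odds\<close>, and that the values lie in \<^const>\<open>pos_odds\<close>.
\<close>

definition reduced_collatz :: "nat \<Rightarrow> nat" where
  "reduced_collatz n = (3 * n + 1) div 2 ^ multiplicity 2 (3 * n + 1)"

lemma reduced_collatz_exact:
  fixes n :: nat
  shows "2 ^ multiplicity 2 (3 * n + 1) * reduced_collatz n = 3 * n + 1"
  unfolding reduced_collatz_def by (rule dvd_mult_div_cancel) (rule multiplicity_dvd)

lemma reduced_collatz_exponent_largest:
  fixes n a :: nat
  shows "2 ^ a dvd 3 * n + 1 \<longleftrightarrow> a \<le> multiplicity 2 (3 * n + 1)"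
  by (rule power_dvd_iff_le_multiplicity) auto

lemma reduced_collatz_exponent_pos:
  fixes n :: nat
  assumes "n \<in> pos_odds"
  shows "0 < multiplicity 2 (3 * n + 1)"
proof -
  have "2 ^ 1 dvd 3 * n + 1" using assms by (simp add: pos_odds_def)
  then show ?thesis unfolding reduced_collatz_exponent_largest by simp
qed

lemma reduced_collatz_in_pos_odds:
  fixes n :: nat
  shows "reduced_collatz n \<in> pos_odds"
proof -
  have "\<not> 2 dvd (3 * n + 1) div 2 ^ multiplicity 2 (3 * n + 1)"
    by (rule multiplicity_decompose) auto
  then have "odd (reduced_collatz n)"
    by (simp add: reduced_collatz_def)
  then show ?thesis by (auto simp: pos_odds_def intro: Nat.gr0I)
qed

end

(* With e the difference of the two exponents of 2 in the formula, q = (2^e - 1) / 3 is an odd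
   integer and 3 n + 1 = 2^a1 q, so C(n) = q and C(q) = 1.  The sign (-1)^(a1 mod 2) makes
   2^e congruent to 4 or 7 modulo 9, so that q is congruent to 2^a1 modulo 3, and hence
   2^a1 q is congruent to 1. *)

theory Submission
  imports Defs
begin

text \<open>As \<open>q\<close> is odd, \<open>2 ^ k\<close> is the full power of 2 in
  \<open>3 * m + 1\<close>.\<close>

lemma reduced_collatz_eqI:
  assumes "3 * m + 1 = 2 ^ k * q" and "odd q"
  shows "reduced_collatz m = q"
proof -
  have "multiplicity 2 (2 ^ k * q) = k"
    by (rule multiplicity_eqI) (use assms(2) in auto)
  then show ?thesis
    unfolding reduced_collatz_def assms(1) by simp
qed

lemma power_2_mod_3: "(2::nat) ^ a mod 3 = (if even a then 1 else 2)"
proof (induction a)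
  case (Suc a)
  have "(2::nat) ^ Suc a mod 3 = 2 * (2 ^ a mod 3) mod 3"
    by (simp add: mod_mult_right_eq)
  with Suc show ?case by auto
qed simp

text \<open>The period is 6 because \<open>2 ^ 6 = 64\<close> is 1 modulo 9.\<close>

lemma power_2_mod_9_periodic: "(2::nat) ^ (6 * c + d) mod 9 = 2 ^ d mod 9"
proof -
  have "(2::nat) ^ (6 * c) mod 9 = (2 ^ 6 mod 9) ^ c mod 9"
    unfolding power_mult power_mod ..
  then have "(2::nat) ^ (6 * c) mod 9 = 1" by simp
  then show ?thesis
    by (metis mod_mult_left_eq mult_1 power_add)
qed

theorem theorem2p7:
  fixes a1 b :: nat and n :: real
  assumes "a1 \<ge> 1" and "b \<ge> 1"
    and "n = 2 powi (int a1 + 6 * int b + 2 * (-1) ^ (a1 mod 2)) / 3 ^ 2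
             - 2 ^ a1 / 3 ^ 2 - 2 ^ 0 / 3 ^ 1"
  shows "\<exists>m \<in> pos_odds. n = real m \<and> (reduced_collatz ^^ 2) m = 1"
proof -
  \<comment> \<open>A natural \<open>e\<close> lets \<open>powi\<close> become an ordinary
    power.\<close>
  obtain e where e: "int a1 + 6 * int b + 2 * (-1) ^ (a1 mod 2) = int (a1 + e)"
    and e9: "(2::nat) ^ e mod 9 = (if even a1 then 4 else 7)" and "e > 0"
  proof (cases "even a1")
    case True
    with that[of "6 * b + 2"] show thesis
      by (simp add: power_2_mod_9_periodic del: add_2_eq_Suc')
  next
    case False
    \<comment> \<open>This is \<open>6 * b - 2\<close> as a multiple of the period plus 4, valid as
      \<open>b \<ge> 1\<close>; \<open>2 ^ 4 = 16\<close> is 7 modulo 9.\<close>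
    with that[of "6 * (b - 1) + 4"] \<open>b \<ge> 1\<close> show thesis
      by (simp add: power_2_mod_9_periodic odd_iff_mod_2_eq_one of_nat_diff)
  qed
  define q where "q = (2::nat) ^ e div 3"
  \<comment> \<open>If \<open>2 ^ e\<close> is \<open>9 * k + 4\<close> or \<open>9 * k + 7\<close>,
    then \<open>q\<close> is \<open>3 * k + 1\<close> or \<open>3 * k + 2\<close>.\<close>
  have q: "3 * q + 1 = 2 ^ e" and q3: "q mod 3 = 2 ^ a1 mod 3"
    using e9 unfolding q_def power_2_mod_3 by (simp_all split: if_splits; presburger)+
  have "even (3 * q + 1)"
    unfolding q using \<open>e > 0\<close> by simp
  then have "odd q" by simp
  define m where "m = 2 ^ a1 * q div 3"
  \<comment> \<open>Modulo 3 the product is the square of a nonzero residue.\<close>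
  have "2 ^ a1 * q mod 3 = (2 ^ a1 mod 3) * (2 ^ a1 mod 3) mod 3"
    by (metis mod_mult_eq q3)
  also have "\<dots> = 1"
    by (simp add: power_2_mod_3)
  finally have m: "3 * m + 1 = 2 ^ a1 * q"
    unfolding m_def by presburger
  have "even (3 * m + 1)"
    unfolding m using \<open>a1 \<ge> 1\<close> by simp
  then have "odd m" by simp
  then have "m \<in> pos_odds"
    by (auto simp: pos_odds_def intro: Nat.gr0I)
  moreover have "n = real m"
  proof -
    \<comment> \<open>The formula for \<open>n\<close>, cleared of its denominator 9: three times
      \<open>m\<close>'s equation, plus \<open>2 ^ a1\<close>.\<close>
    have "real (9 * m + 3 + 2 ^ a1) = real (2 ^ a1 * (3 * q + 1))"
      using m by (simp only: of_nat_eq_iff) (simp add: algebra_simps)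
    also have "\<dots> = 2 ^ (a1 + e)"
      unfolding q by (simp add: power_add)
    finally show ?thesis
      unfolding assms(3) e power_int_of_nat by simp
  qed
  moreover have "reduced_collatz m = q"
    using m \<open>odd q\<close> by (rule reduced_collatz_eqI)
  moreover have "reduced_collatz q = 1"
    by (rule reduced_collatz_eqI[of q e]) (use q in simp_all)
  ultimately show ?thesis
    by (auto simp: numeral_2_eq_2)
qed

end
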